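(* Let $\mathcal{E}$ be a tribe. Then the underlying clan of $\mathcal{E}$, equipped with the class of homotopy equivalences as its class of acyclic maps (weak equivalences), is a Brown fibration category.
   Context: A clan is a category $\mathcal{E}$ with a terminal object $1$, equipped with a class of maps called fibrations, such that: every isomorphism is a fibration; fibrations are closed under composition; for every fibration $p:C\to B$ and every map $f:A\to B$ the fibre product $A\times_B C$ exists and the projection $A\times_B C\to A$ (the base change of $p$ along $f$) is a fibration; and $X\to 1$ is a fibration for every object $X$. In particular a clan has finite products. A map in a clan is anodyne if it has the left lifting property with respect to every fibration. A tribe is a clan in which every map factors as an anodyne map followed by a fibration, and in which the base change of an anodyne map along a fibration is anodyne. In a tribe, a path object for an object $B$ is a quadruple $(PB,\partial_0,\partial_1,\sigma)$ where $\sigma:B\to PB$ is anodyne, $(\partial_0,\partial_1):PB\to B\times B$ is a fibration and $(\partial_0,\partial_1)\sigma=(1_B,1_B)$. Two maps $f,g:A\to B$ are homotopic, $f\sim g$, if there is a map $H:A\to PB$ with $\partial_0H=f$ and $\partial_1H=g$ (independent of the choice of path object). Homotopy is a congruence on $\mathcal{E}$; the quotient category is the homotopy category $Ho(\mathcal{E})$. A map is a homotopy equivalence if its class is invertible in $Ho(\mathcal{E})$. A (Brown) fibration category is a clan equipped with a class of maps called acyclic such that: every isomorphism is acyclic; the class of acyclic maps has the 3-for-2 property (if two of $u$, $v$, $vu$ are acyclic, so is the third); every map can be factored as an acyclic map followed by a fibration; and the class of acyclic fibrations (maps that are both acyclic and fibrations) is stable under base change along arbitrary maps. *)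

theory Defs
  imports Main
begin

section \<open>Categories\<close>

text \<open>
  Objects and arrows are carved out of arbitrary types by carrier sets. Composition is in
  applicative order and is only meaningful on composable pairs of arrows.
\<close>

record ('o, 'm) cat =
  Ob :: "'o set"
  Mor :: "'m set"
  Dom :: "'m \<Rightarrow> 'o"
  Cod :: "'m \<Rightarrow> 'o"
  Idn :: "'o \<Rightarrow> 'm"
  Comp :: "'m \<Rightarrow> 'm \<Rightarrow> 'm" (infixl "\<cdot>\<index>" 70)

definition hom :: "('o, 'm) cat \<Rightarrow> 'o \<Rightarrow> 'o \<Rightarrow> 'm set" where
  "hom C A B = {f \<in> Mor C. Dom C f = A \<and> Cod C f = B}"

locale category =
  fixes C :: "('o, 'm) cat" (structure)
  assumes Dom_in_Ob: "f \<in> Mor C \<Longrightarrow> Dom C f \<in> Ob C"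
    and Cod_in_Ob: "f \<in> Mor C \<Longrightarrow> Cod C f \<in> Ob C"
    and Idn_in_hom: "A \<in> Ob C \<Longrightarrow> Idn C A \<in> hom C A A"
    and Comp_in_hom: "\<lbrakk>f \<in> hom C X Y; g \<in> hom C Y Z\<rbrakk> \<Longrightarrow> g \<cdot> f \<in> hom C X Z"
    and Comp_Idn_right: "f \<in> hom C X Y \<Longrightarrow> f \<cdot> Idn C X = f"
    and Comp_Idn_left: "f \<in> hom C X Y \<Longrightarrow> Idn C Y \<cdot> f = f"
    and Comp_assoc: "\<lbrakk>f \<in> hom C X Y; g \<in> hom C Y Z; h \<in> hom C Z W\<rbrakk>
      \<Longrightarrow> (h \<cdot> g) \<cdot> f = h \<cdot> (g \<cdot> f)"

definition is_iso :: "('o, 'm) cat \<Rightarrow> 'm \<Rightarrow> bool" where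
  "is_iso C f \<longleftrightarrow> f \<in> Mor C \<and>
     (\<exists>g \<in> hom C (Cod C f) (Dom C f).
        g \<cdot>\<^bsub>C\<^esub> f = Idn C (Dom C f) \<and> f \<cdot>\<^bsub>C\<^esub> g = Idn C (Cod C f))"

definition is_terminal :: "('o, 'm) cat \<Rightarrow> 'o \<Rightarrow> bool" where
  "is_terminal C T \<longleftrightarrow> T \<in> Ob C \<and> (\<forall>X \<in> Ob C. \<exists>!f. f \<in> hom C X T)"

definition is_product :: "('o, 'm) cat \<Rightarrow> 'o \<Rightarrow> 'o \<Rightarrow> 'o \<Rightarrow> 'm \<Rightarrow> 'm \<Rightarrow> bool" where
  "is_product C A B P p1 p2 \<longleftrightarrow>
     P \<in> Ob C \<and> p1 \<in> hom C P A \<and> p2 \<in> hom C P B \<and>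
     (\<forall>X \<in> Ob C. \<forall>f \<in> hom C X A. \<forall>g \<in> hom C X B.
        \<exists>!h. h \<in> hom C X P \<and> p1 \<cdot>\<^bsub>C\<^esub> h = f \<and> p2 \<cdot>\<^bsub>C\<^esub> h = g)"

text \<open>
  In \<open>is_pullback C f p q1 q2\<close>, with \<open>f : A \<rightarrow> B\<close> and \<open>p : D \<rightarrow> B\<close>, the arrows
  \<open>q1 : A \<times>\<^sub>B D \<rightarrow> A\<close> (the base change of \<open>p\<close> along \<open>f\<close>) and
  \<open>q2 : A \<times>\<^sub>B D \<rightarrow> D\<close> (the base change of \<open>f\<close> along \<open>p\<close>) are the projections.
\<close>

definition is_pullback :: "('o, 'm) cat \<Rightarrow> 'm \<Rightarrow> 'm \<Rightarrow> 'm \<Rightarrow> 'm \<Rightarrow> bool" where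
  "is_pullback C f p q1 q2 \<longleftrightarrow>
     f \<in> Mor C \<and> p \<in> Mor C \<and> q1 \<in> Mor C \<and> q2 \<in> Mor C \<and>
     Cod C f = Cod C p \<and> Dom C q1 = Dom C q2 \<and>
     Cod C q1 = Dom C f \<and> Cod C q2 = Dom C p \<and>
     f \<cdot>\<^bsub>C\<^esub> q1 = p \<cdot>\<^bsub>C\<^esub> q2 \<and>
     (\<forall>X \<in> Ob C. \<forall>a \<in> hom C X (Dom C f). \<forall>d \<in> hom C X (Dom C p).
        f \<cdot>\<^bsub>C\<^esub> a = p \<cdot>\<^bsub>C\<^esub> d \<longrightarrow>
        (\<exists>!h. h \<in> hom C X (Dom C q1) \<and> q1 \<cdot>\<^bsub>C\<^esub> h = a \<and> q2 \<cdot>\<^bsub>C\<^esub> h = d))"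


section \<open>Clans and tribes\<close>

locale clan = category C
  for C :: "('o, 'm) cat" (structure) +
  fixes F :: "'m set"
  assumes fibrations_subset: "F \<subseteq> Mor C"
    and iso_fibration: "is_iso C f \<Longrightarrow> f \<in> F"
    and comp_fibration: "\<lbrakk>f \<in> F; g \<in> F; Dom C g = Cod C f\<rbrakk> \<Longrightarrow> g \<cdot> f \<in> F"
    and fibre_product_exists: "\<lbrakk>p \<in> F; f \<in> Mor C; Cod C f = Cod C p\<rbrakk>
      \<Longrightarrow> \<exists>q1 q2. is_pullback C f p q1 q2"
    and base_change_fibration: "\<lbrakk>p \<in> F; is_pullback C f p q1 q2\<rbrakk> \<Longrightarrow> q1 \<in> F"
    and terminal_fibration: "\<exists>T. is_terminal C T \<and> (\<forall>X \<in> Ob C. hom C X T \<subseteq> F)"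

definition is_anodyne :: "('o, 'm) cat \<Rightarrow> 'm set \<Rightarrow> 'm \<Rightarrow> bool" where
  "is_anodyne C F i \<longleftrightarrow> i \<in> Mor C \<and>
     (\<forall>p \<in> F. \<forall>u \<in> hom C (Dom C i) (Dom C p). \<forall>v \<in> hom C (Cod C i) (Cod C p).
        p \<cdot>\<^bsub>C\<^esub> u = v \<cdot>\<^bsub>C\<^esub> i \<longrightarrow>
        (\<exists>d \<in> hom C (Cod C i) (Dom C p). d \<cdot>\<^bsub>C\<^esub> i = u \<and> p \<cdot>\<^bsub>C\<^esub> d = v))"

locale tribe = clan C F
  for C :: "('o, 'm) cat" (structure) and F :: "'m set" +
  assumes anodyne_factorization: "f \<in> Mor C
      \<Longrightarrow> \<exists>i p. is_anodyne C F i \<and> p \<in> F \<and> Dom C p = Cod C i \<and> p \<cdot> i = f"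
    and base_change_anodyne: "\<lbrakk>is_anodyne C F i; p \<in> F; is_pullback C i p q1 q2\<rbrakk>
      \<Longrightarrow> is_anodyne C F q2"


section \<open>Homotopy\<close>

text \<open>
  The arrow \<open>d\<close> below is \<open>(\<partial>\<^sub>0, \<partial>\<^sub>1) : P \<rightarrow> B \<times> B\<close>; the equation
  \<open>(\<partial>\<^sub>0, \<partial>\<^sub>1) \<sigma> = (1\<^sub>B, 1\<^sub>B)\<close> is written componentwise. Any two products \<open>B \<times> B\<close> are
  isomorphic and isomorphisms are fibrations, so in a clan it does not matter which one is used.
\<close>

definition is_path_object ::
  "('o, 'm) cat \<Rightarrow> 'm set \<Rightarrow> 'o \<Rightarrow> 'o \<Rightarrow> 'm \<Rightarrow> 'm \<Rightarrow> 'm \<Rightarrow> bool" where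
  "is_path_object C F B P d0 d1 s \<longleftrightarrow>
     B \<in> Ob C \<and> P \<in> Ob C \<and>
     d0 \<in> hom C P B \<and> d1 \<in> hom C P B \<and> s \<in> hom C B P \<and>
     is_anodyne C F s \<and>
     (\<exists>BB p1 p2 d. is_product C B B BB p1 p2 \<and>
        d \<in> hom C P BB \<and> p1 \<cdot>\<^bsub>C\<^esub> d = d0 \<and> p2 \<cdot>\<^bsub>C\<^esub> d = d1 \<and> d \<in> F) \<and>
     d0 \<cdot>\<^bsub>C\<^esub> s = Idn C B \<and> d1 \<cdot>\<^bsub>C\<^esub> s = Idn C B"

definition homotopic :: "('o, 'm) cat \<Rightarrow> 'm set \<Rightarrow> 'm \<Rightarrow> 'm \<Rightarrow> bool" where
  "homotopic C F f g \<longleftrightarrow> f \<in> Mor C \<and> g \<in> hom C (Dom C f) (Cod C f) \<and>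
     (\<exists>P d0 d1 s. is_path_object C F (Cod C f) P d0 d1 s \<and>
        (\<exists>H \<in> hom C (Dom C f) P. d0 \<cdot>\<^bsub>C\<^esub> H = f \<and> d1 \<cdot>\<^bsub>C\<^esub> H = g))"

definition homotopy_rel :: "('o, 'm) cat \<Rightarrow> 'm set \<Rightarrow> ('m \<times> 'm) set" where
  "homotopy_rel C F = {(f, g). homotopic C F f g}"

text \<open>
  The quotient of the category by the congruence \<open>homotopy_rel C F\<close>. Domain, codomain and
  composition are given by the values on representatives.
\<close>

definition homotopy_category :: "('o, 'm) cat \<Rightarrow> 'm set \<Rightarrow> ('o, 'm set) cat" where
  "homotopy_category C F =
     \<lparr>Ob = Ob C,
      Mor = Mor C // homotopy_rel C F,
      Dom = (\<lambda>c. the_elem (Dom C ` c)),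
      Cod = (\<lambda>c. the_elem (Cod C ` c)),
      Idn = (\<lambda>A. homotopy_rel C F `` {Idn C A}),
      Comp = (\<lambda>d c. \<Union>g \<in> d. \<Union>f \<in> c. homotopy_rel C F `` {g \<cdot>\<^bsub>C\<^esub> f})\<rparr>"

definition homotopy_equivalences :: "('o, 'm) cat \<Rightarrow> 'm set \<Rightarrow> 'm set" where
  "homotopy_equivalences C F =
     {f \<in> Mor C. is_iso (homotopy_category C F) (homotopy_rel C F `` {f})}"


section \<open>Brown fibration categories\<close>

locale fibration_category = clan C F
  for C :: "('o, 'm) cat" (structure) and F :: "'m set" +
  fixes W :: "'m set"
  assumes acyclic_subset: "W \<subseteq> Mor C"
    and iso_acyclic: "is_iso C f \<Longrightarrow> f \<in> W"
    and acyclic_comp: "\<lbrakk>u \<in> hom C X Y; v \<in> hom C Y Z; u \<in> W; v \<in> W\<rbrakk> \<Longrightarrow> v \<cdot> u \<in> W"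
    and acyclic_cancel_left: "\<lbrakk>u \<in> hom C X Y; v \<in> hom C Y Z; v \<in> W; v \<cdot> u \<in> W\<rbrakk> \<Longrightarrow> u \<in> W"
    and acyclic_cancel_right: "\<lbrakk>u \<in> hom C X Y; v \<in> hom C Y Z; u \<in> W; v \<cdot> u \<in> W\<rbrakk> \<Longrightarrow> v \<in> W"
    and acyclic_factorization: "f \<in> Mor C
      \<Longrightarrow> \<exists>w p. w \<in> W \<and> p \<in> F \<and> Dom C p = Cod C w \<and> p \<cdot> w = f"
    and base_change_acyclic_fibration: "\<lbrakk>p \<in> F \<inter> W; is_pullback C f p q1 q2\<rbrakk>
      \<Longrightarrow> q1 \<in> F \<inter> W"

end

theory Submission
  imports Defs
begin

text \<open>
  Lifting anodyne maps against \<open>(\<partial>\<^sub>0, \<partial>\<^sub>1) : PB \<rightarrow> B \<times> B\<close> shows that homotopy is independent of the path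
  object and that two maps agreeing after precomposition with an anodyne map are homotopic. In
  particular anodyne maps are homotopy equivalences, which gives the factorization axiom.

  For a fibration \<open>p : X \<rightarrow> B\<close> that is a homotopy equivalence, the homotopy lifting property
  yields \<open>s\<close> with \<open>p s = 1\<close> and \<open>s p \<sim> 1\<close>. Let \<open>p' : Y \<rightarrow> A\<close> be the base change of \<open>p\<close> along a
  fibration \<open>f\<close>, with projection \<open>f' : Y \<rightarrow> X\<close> and induced section \<open>s'\<close>. Lifting the homotopy
  \<open>f' \<sim> s p f'\<close> through the fibration \<open>f'\<close> deforms \<open>1\<close> to some \<open>e\<close> with \<open>f' e = s p f'\<close>, and then
  \<open>e = s' (p' e)\<close>. So \<open>s'\<close> has the left inverse \<open>p'\<close> and the right homotopy inverse \<open>p' e\<close>, and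
  \<open>p'\<close> is a homotopy equivalence; no fibrewise homotopies are needed. Along an anodyne map the
  base change of \<open>p\<close> is handled by 3-for-2, since anodyne maps are stable under base change along
  fibrations, and a general map is an anodyne map followed by a fibration.
\<close>

section \<open>Pullbacks and products in a category\<close>

context category
begin

lemma homD:
  assumes "f \<in> hom C X Y"
  shows "f \<in> Mor C" "Dom C f = X" "Cod C f = Y" "X \<in> Ob C" "Y \<in> Ob C"
  using assms Dom_in_Ob Cod_in_Ob by (auto simp: hom_def)

lemma is_pullbackI:
  assumes "f \<in> hom C A B" "p \<in> hom C D B" "q1 \<in> hom C Q A" "q2 \<in> hom C Q D"
    and "f \<cdot> q1 = p \<cdot> q2"
    and "\<And>X a d. \<lbrakk>a \<in> hom C X A; d \<in> hom C X D; f \<cdot> a = p \<cdot> d\<rbrakk>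
      \<Longrightarrow> \<exists>!h. h \<in> hom C X Q \<and> q1 \<cdot> h = a \<and> q2 \<cdot> h = d"
  shows "is_pullback C f p q1 q2"
proof -
  have "Dom C f = A" "Dom C p = D" "Dom C q1 = Q" "Dom C q2 = Q" "Cod C q1 = A" "Cod C q2 = D"
    "Cod C f = B" "Cod C p = B" "f \<in> Mor C" "p \<in> Mor C" "q1 \<in> Mor C" "q2 \<in> Mor C"
    using homD(1-3)[OF assms(1)] homD(1-3)[OF assms(2)] homD(1-3)[OF assms(3)]
      homD(1-3)[OF assms(4)] by simp_all
  note eqs = this
  show ?thesis
    unfolding is_pullback_def eqs by (intro conjI ballI impI assms(5,6) eqs refl)
qed

lemma pullback_square:
  assumes "is_pullback C f p q1 q2" "f \<in> hom C A B" "p \<in> hom C D B"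
  shows "q1 \<in> hom C (Dom C q1) A" "q2 \<in> hom C (Dom C q1) D" "f \<cdot> q1 = p \<cdot> q2"
  using assms unfolding is_pullback_def by (auto simp: hom_def)

lemma pullback_ex1:
  assumes "is_pullback C f p q1 q2" "f \<in> hom C A B" "p \<in> hom C D B"
    and "a \<in> hom C X A" "d \<in> hom C X D" "f \<cdot> a = p \<cdot> d"
  shows "\<exists>!h. h \<in> hom C X (Dom C q1) \<and> q1 \<cdot> h = a \<and> q2 \<cdot> h = d"
proof -
  have "X \<in> Ob C" "Dom C f = A" "Dom C p = D" using assms(2-4) homD by auto
  then show ?thesis using assms unfolding is_pullback_def by blast
qed

lemma pullback_eqI:
  assumes "is_pullback C f p q1 q2" "f \<in> hom C A B" "p \<in> hom C D B"
    and "h \<in> hom C X (Dom C q1)" "h' \<in> hom C X (Dom C q1)"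
    and "q1 \<cdot> h = q1 \<cdot> h'" "q2 \<cdot> h = q2 \<cdot> h'"
  shows "h = h'"
proof -
  note q = pullback_square[OF assms(1-3)]
  have "f \<cdot> (q1 \<cdot> h) = p \<cdot> (q2 \<cdot> h)"
    using Comp_assoc[OF assms(4) q(1) assms(2)] Comp_assoc[OF assms(4) q(2) assms(3)] q(3) by simp
  from pullback_ex1[OF assms(1-3) Comp_in_hom[OF assms(4) q(1)] Comp_in_hom[OF assms(4) q(2)] this]
  show ?thesis using assms(4-7) by metis
qed

lemma pullback_swap:
  assumes "is_pullback C f p q1 q2"
  shows "is_pullback C p f q2 q1"
proof -
  have f: "f \<in> hom C (Dom C f) (Cod C f)" and p: "p \<in> hom C (Dom C p) (Cod C f)"
    using assms unfolding is_pullback_def hom_def by auto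
  note q = pullback_square[OF assms f p]
  show ?thesis
  proof (rule is_pullbackI[OF p f q(2,1) q(3)[symmetric]])
    fix X a d assume "a \<in> hom C X (Dom C p)" "d \<in> hom C X (Dom C f)" "p \<cdot> a = f \<cdot> d"
    from pullback_ex1[OF assms f p this(2,1) this(3)[symmetric]]
    show "\<exists>!h. h \<in> hom C X (Dom C q1) \<and> q2 \<cdot> h = a \<and> q1 \<cdot> h = d" by metis
  qed
qed

text \<open>Half of the pasting law for pullbacks. It later splits a base change along
  \<open>g \<cdot> j\<close> into a base change along \<open>g\<close> followed by one along
  \<open>j\<close>.\<close>

lemma pullback_cancel:
  assumes pb: "is_pullback C (g \<cdot> j) p q1 q2" and pbg: "is_pullback C g p r1 r2"
    and j: "j \<in> hom C A Z" and g: "g \<in> hom C Z B" and p: "p \<in> hom C D B"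
  obtains k where "is_pullback C j r1 q1 k" "k \<in> hom C (Dom C q1) (Dom C r1)" "r2 \<cdot> k = q2"
proof -
  let ?Q = "Dom C q1" and ?R = "Dom C r1"
  have gj: "g \<cdot> j \<in> hom C A B" using Comp_in_hom j g .
  note q = pullback_square[OF pb gj p] and r = pullback_square[OF pbg g p]
  have "g \<cdot> (j \<cdot> q1) = p \<cdot> q2" using Comp_assoc[OF q(1) j g] q(3) by simp
  from pullback_ex1[OF pbg g p Comp_in_hom[OF q(1) j] q(2) this]
  obtain k where k: "k \<in> hom C ?Q ?R" "r1 \<cdot> k = j \<cdot> q1" "r2 \<cdot> k = q2" by blast
  have "is_pullback C j r1 q1 k"
  proof (rule is_pullbackI[OF j r(1) q(1) k(1) k(2)[symmetric]])
    fix X a e assume a: "a \<in> hom C X A" and e: "e \<in> hom C X ?R" and eq: "j \<cdot> a = r1 \<cdot> e"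
    have "(g \<cdot> j) \<cdot> a = g \<cdot> (r1 \<cdot> e)" using Comp_assoc[OF a j g] eq by simp
    also have "\<dots> = p \<cdot> (r2 \<cdot> e)" using Comp_assoc[OF e r(1) g] Comp_assoc[OF e r(2) p] r(3) by simp
    finally have eq': "(g \<cdot> j) \<cdot> a = p \<cdot> (r2 \<cdot> e)" .
    \<comment> \<open>The \<open>r1\<close> components of \<open>k \<cdot> h\<close> and
      \<open>e\<close> agree already, so only the \<open>r2\<close> components have to be compared.
      Existence and uniqueness then both transfer from the outer pullback.\<close>
    have iff: "k \<cdot> h = e \<longleftrightarrow> q2 \<cdot> h = r2 \<cdot> e"
      if h: "h \<in> hom C X ?Q" and ha: "q1 \<cdot> h = a" for h
    proof
      show "q2 \<cdot> h = r2 \<cdot> e" if "k \<cdot> h = e" using that Comp_assoc[OF h k(1) r(2)] k(3) by simp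
      assume *: "q2 \<cdot> h = r2 \<cdot> e"
      have "r1 \<cdot> (k \<cdot> h) = r1 \<cdot> e"
        using Comp_assoc[OF h k(1) r(1)] Comp_assoc[OF h q(1) j] k(2) ha eq by simp
      moreover have "r2 \<cdot> (k \<cdot> h) = r2 \<cdot> e" using Comp_assoc[OF h k(1) r(2)] k(3) * by simp
      ultimately show "k \<cdot> h = e" using pullback_eqI[OF pbg g p Comp_in_hom[OF h k(1)] e] by blast
    qed
    show "\<exists>!h. h \<in> hom C X ?Q \<and> q1 \<cdot> h = a \<and> k \<cdot> h = e"
      using pullback_ex1[OF pb gj p a Comp_in_hom[OF e r(2)] eq'] iff by metis
  qed
  then show ?thesis using that k by blast
qed

lemma product_ex1:
  assumes "is_product C A B P p1 p2" "f \<in> hom C X A" "g \<in> hom C X B"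
  shows "\<exists>!h. h \<in> hom C X P \<and> p1 \<cdot> h = f \<and> p2 \<cdot> h = g"
  using assms homD(4)[OF assms(2)] unfolding is_product_def by blast

lemma is_product_swap:
  assumes "is_product C A B P p1 p2"
  shows "is_product C B A P p2 p1"
proof -
  have "\<exists>!h. h \<in> hom C X P \<and> p2 \<cdot> h = f \<and> p1 \<cdot> h = g"
    if "f \<in> hom C X B" "g \<in> hom C X A" for X f g
    using product_ex1[OF assms that(2,1)] by metis
  then show ?thesis using assms unfolding is_product_def by simp
qed

lemma product_hom:
  assumes "is_product C A B P p1 p2"
  shows "p1 \<in> hom C P A" "p2 \<in> hom C P B"
  using assms unfolding is_product_def by auto

lemma product_eqI:
  assumes "is_product C A B P p1 p2" "h \<in> hom C X P" "h' \<in> hom C X P"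
    and "p1 \<cdot> h = p1 \<cdot> h'" "p2 \<cdot> h = p2 \<cdot> h'"
  shows "h = h'"
proof -
  note p = product_hom[OF assms(1)]
  from product_ex1[OF assms(1) Comp_in_hom[OF assms(2) p(1)] Comp_in_hom[OF assms(2) p(2)]]
  show ?thesis using assms(2-5) by metis
qed

text \<open>Every square ending in a terminal object commutes, so the pullback condition imposes
  nothing. This lets the clan axioms on fibre products yield binary products and show that their
  projections are fibrations.\<close>

lemma product_iff_pullback:
  assumes T: "is_terminal C T" and a: "a \<in> hom C A T" and b: "b \<in> hom C B T"
    and p: "p1 \<in> hom C P A" "p2 \<in> hom C P B"
  shows "is_product C A B P p1 p2 \<longleftrightarrow> is_pullback C a b p1 p2"
proof -
  have eq: "a \<cdot> f = b \<cdot> g" if "f \<in> hom C X A" "g \<in> hom C X B" for X f g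
    using T Comp_in_hom[OF that(1) a] Comp_in_hom[OF that(2) b] homD(4)[OF that(1)]
    unfolding is_terminal_def by blast
  show ?thesis
  proof
    assume "is_product C A B P p1 p2"
    then show "is_pullback C a b p1 p2"
      using product_ex1 by (intro is_pullbackI[OF a b p eq[OF p]])
  next
    assume pb: "is_pullback C a b p1 p2"
    show "is_product C A B P p1 p2"
      using pullback_ex1[OF pb a b _ _ eq] p homD unfolding is_product_def by auto
  qed
qed

end

section \<open>Products, lifting and path objects in a clan\<close>

context clan
begin

lemma product_exists:
  assumes "A \<in> Ob C" "B \<in> Ob C"
  obtains P p1 p2 where "is_product C A B P p1 p2"
proof -
  obtain T where T: "is_terminal C T" "\<forall>X \<in> Ob C. hom C X T \<subseteq> F"
    using terminal_fibration by blast
  obtain a b where a: "a \<in> hom C A T" and b: "b \<in> hom C B T"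
    using T(1) assms unfolding is_terminal_def by blast
  have "b \<in> F" using T(2) b assms by blast
  then obtain p1 p2 where pb: "is_pullback C a b p1 p2"
    using fibre_product_exists[of b a] homD[OF a] homD[OF b] by auto
  show ?thesis
    using that pb product_iff_pullback[OF T(1) a b] pullback_square[OF pb a b] by blast
qed

lemma product_fibration:
  assumes "is_product C A B P p1 p2"
  shows "p1 \<in> F"
proof -
  have AB: "A \<in> Ob C" "B \<in> Ob C" using product_hom[OF assms] homD by auto
  obtain T where T: "is_terminal C T" "\<forall>X \<in> Ob C. hom C X T \<subseteq> F"
    using terminal_fibration by blast
  obtain a b where a: "a \<in> hom C A T" and b: "b \<in> hom C B T"
    using T(1) AB unfolding is_terminal_def by blast
  have "is_pullback C a b p1 p2"
    using product_iff_pullback[OF T(1) a b product_hom[OF assms]] assms by blast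
  moreover have "b \<in> F" using T(2) b AB by blast
  ultimately show ?thesis by (rule base_change_fibration[rotated])
qed

lemma anodyne_lift:
  assumes "is_anodyne C F i" "i \<in> hom C A X" "p \<in> F" "p \<in> hom C Y Z"
    and "u \<in> hom C A Y" "v \<in> hom C X Z" "p \<cdot> u = v \<cdot> i"
  obtains d where "d \<in> hom C X Y" "d \<cdot> i = u" "p \<cdot> d = v"
proof -
  have "Dom C i = A" "Cod C i = X" "Dom C p = Y" "Cod C p = Z"
    using assms(2,4) homD by auto
  then show ?thesis using assms that unfolding is_anodyne_def by blast
qed

lemma path_object_hom:
  assumes "is_path_object C F B P d0 d1 s"
  shows "d0 \<in> hom C P B" "d1 \<in> hom C P B" "s \<in> hom C B P"
    "d0 \<cdot> s = Idn C B" "d1 \<cdot> s = Idn C B" "is_anodyne C F s"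
  using assms unfolding is_path_object_def by auto

text \<open>Reversal of paths: it gives the symmetry of homotopy and carries facts about
  \<open>d0\<close> over to \<open>d1\<close>.\<close>

lemma path_object_swap:
  "is_path_object C F B P d0 d1 s \<Longrightarrow> is_path_object C F B P d1 d0 s"
  unfolding is_path_object_def using is_product_swap by blast

lemma path_object_fibration:
  assumes "is_path_object C F B P d0 d1 s"
  shows "d0 \<in> F"
proof -
  obtain BB p1 p2 d where *: "is_product C B B BB p1 p2" "d \<in> hom C P BB" "p1 \<cdot> d = d0" "d \<in> F"
    using assms unfolding is_path_object_def by blast
  then show ?thesis
    using comp_fibration[OF *(4) product_fibration[OF *(1)]] homD[OF *(2)]
      homD[OF product_hom(1)[OF *(1)]] by simp
qed

text \<open>Lifting against the fibration \<open>(d0, d1)\<close>, stated in components so that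
  later proofs never mention the product \<open>BB\<close>.\<close>

lemma path_object_lift:
  assumes P: "is_path_object C F B P d0 d1 s"
    and i: "is_anodyne C F i" "i \<in> hom C A X"
    and u: "u \<in> hom C A P" and v: "v0 \<in> hom C X B" "v1 \<in> hom C X B"
    and eq: "d0 \<cdot> u = v0 \<cdot> i" "d1 \<cdot> u = v1 \<cdot> i"
  obtains w where "w \<in> hom C X P" "w \<cdot> i = u" "d0 \<cdot> w = v0" "d1 \<cdot> w = v1"
proof -
  obtain BB p1 p2 d where *: "is_product C B B BB p1 p2" "d \<in> hom C P BB"
    "p1 \<cdot> d = d0" "p2 \<cdot> d = d1" "d \<in> F"
    using P unfolding is_path_object_def by blast
  note p = product_hom[OF *(1)]
  obtain v where v': "v \<in> hom C X BB" "p1 \<cdot> v = v0" "p2 \<cdot> v = v1"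
    using product_ex1[OF *(1) v] by blast
  have "d \<cdot> u = v \<cdot> i"
    by (rule product_eqI[OF *(1) Comp_in_hom[OF u *(2)] Comp_in_hom[OF i(2) v'(1)]])
      (use Comp_assoc[OF u *(2) p(1)] Comp_assoc[OF u *(2) p(2)]
        Comp_assoc[OF i(2) v'(1) p(1)] Comp_assoc[OF i(2) v'(1) p(2)] eq *(3,4) v'(2,3) in simp_all)
  then obtain w where w: "w \<in> hom C X P" "w \<cdot> i = u" "d \<cdot> w = v"
    using anodyne_lift[OF i *(5,2) u v'(1)] by blast
  show ?thesis
    using that[OF w(1,2)] Comp_assoc[OF w(1) *(2) p(1)] Comp_assoc[OF w(1) *(2) p(2)]
      *(3,4) v'(2,3) w(3) by simp
qed

lemma homotopicI:
  assumes "is_path_object C F B P d0 d1 s" "H \<in> hom C A P"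
  shows "homotopic C F (d0 \<cdot> H) (d1 \<cdot> H)"
proof -
  note d = path_object_hom[OF assms(1)]
  have "d0 \<cdot> H \<in> hom C A B" "d1 \<cdot> H \<in> hom C A B" using Comp_in_hom assms(2) d by blast+
  then show ?thesis using assms unfolding homotopic_def hom_def by auto
qed

lemma homotopic_hom: "homotopic C F f g \<Longrightarrow> f \<in> hom C A B \<longleftrightarrow> g \<in> hom C A B"
  unfolding homotopic_def hom_def by auto

text \<open>Independence of the path object. Lifting the anodyne map \<open>s'\<close> against the
  fibration of \<open>P\<close> gives a comparison map from \<open>P'\<close> to \<open>P\<close>
  over both endpoints, and the given homotopy is pushed along it.\<close>

lemma homotopicE:
  assumes "homotopic C F f g" "f \<in> hom C A B" "is_path_object C F B P d0 d1 s"
  obtains H where "H \<in> hom C A P" "d0 \<cdot> H = f" "d1 \<cdot> H = g"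
proof -
  obtain P' d0' d1' s' H where P': "is_path_object C F B P' d0' d1' s'"
    and H: "H \<in> hom C A P'" "d0' \<cdot> H = f" "d1' \<cdot> H = g"
    using assms(1) homD[OF assms(2)] unfolding homotopic_def by auto
  note d = path_object_hom[OF assms(3)] and d' = path_object_hom[OF P']
  obtain w where w: "w \<in> hom C P' P" "d0 \<cdot> w = d0'" "d1 \<cdot> w = d1'"
    using path_object_lift[OF assms(3) d'(6,3) d(3) d'(1,2)] d(4,5) d'(4,5) by auto
  show ?thesis
    using that[OF Comp_in_hom[OF H(1) w(1)]] Comp_assoc[OF H(1) w(1) d(1)]
      Comp_assoc[OF H(1) w(1) d(2)] w H by simp
qed

end

section \<open>Homotopy as a congruence in a tribe\<close>

context tribe
begin

text \<open>A path object arises by factoring the diagonal of \<open>B\<close> as an anodyne map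
  followed by a fibration.\<close>

lemma path_object_exists:
  assumes "B \<in> Ob C"
  obtains P d0 d1 s where "is_path_object C F B P d0 d1 s"
proof -
  obtain BB p1 p2 where BB: "is_product C B B BB p1 p2" using product_exists assms by blast
  note p = product_hom[OF BB]
  obtain \<delta> where \<delta>: "\<delta> \<in> hom C B BB" "p1 \<cdot> \<delta> = Idn C B" "p2 \<cdot> \<delta> = Idn C B"
    using product_ex1[OF BB] Idn_in_hom[OF assms] by blast
  obtain s d where sd: "is_anodyne C F s" "d \<in> F" "Dom C d = Cod C s" "d \<cdot> s = \<delta>"
    using anodyne_factorization homD(1)[OF \<delta>(1)] by blast
  have s0: "s \<in> hom C (Dom C s) (Cod C s)" and d0: "d \<in> hom C (Cod C s) (Cod C d)"
    using sd fibrations_subset unfolding is_anodyne_def hom_def by auto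
  \<comment> \<open>The factorization axiom only says that the two factors are composable; the outer
    endpoints are read off from the composite.\<close>
  have "Dom C s = B" "Cod C d = BB"
    using Comp_in_hom[OF s0 d0] sd(4) homD[OF \<delta>(1)] homD by auto
  then have s: "s \<in> hom C B (Cod C s)" and d: "d \<in> hom C (Cod C s) BB" using s0 d0 by auto
  have "is_path_object C F B (Cod C s) (p1 \<cdot> d) (p2 \<cdot> d) s"
    unfolding is_path_object_def
    using assms homD(5)[OF s] Comp_in_hom[OF d p(1)] Comp_in_hom[OF d p(2)] s sd(1,2,4) BB d
      Comp_assoc[OF s d p(1)] Comp_assoc[OF s d p(2)] \<delta> by auto
  then show ?thesis by (rule that)
qed

text \<open>The constant homotopy \<open>s \<cdot> (u \<cdot> i)\<close> on \<open>A\<close> extends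
  along \<open>i\<close> to a homotopy on \<open>X\<close> with the prescribed ends \<open>u\<close>
  and \<open>v\<close>.\<close>

lemma anodyne_comp_eq_homotopic:
  assumes i: "is_anodyne C F i" "i \<in> hom C A X"
    and uv: "u \<in> hom C X B" "v \<in> hom C X B" and eq: "u \<cdot> i = v \<cdot> i"
  shows "homotopic C F u v"
proof -
  obtain P d0 d1 s where P: "is_path_object C F B P d0 d1 s"
    using path_object_exists homD(5)[OF uv(1)] by blast
  note d = path_object_hom[OF P]
  have ui: "u \<cdot> i \<in> hom C A B" using Comp_in_hom i(2) uv(1) .
  obtain w where "w \<in> hom C X P" "d0 \<cdot> w = u" "d1 \<cdot> w = v"
    using path_object_lift[OF P i Comp_in_hom[OF ui d(3)] uv] Comp_assoc[OF ui d(3) d(1)]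
      Comp_assoc[OF ui d(3) d(2)] d(4,5) Comp_Idn_left[OF ui] eq by metis
  then show ?thesis using homotopicI[OF P] by auto
qed

lemma homotopic_refl:
  assumes "f \<in> hom C A B"
  shows "homotopic C F f f"
proof -
  obtain P d0 d1 s where P: "is_path_object C F B P d0 d1 s"
    using path_object_exists homD(5)[OF assms] by blast
  note d = path_object_hom[OF P]
  show ?thesis
    using homotopicI[OF P Comp_in_hom[OF assms d(3)]] Comp_assoc[OF assms d(3) d(1)]
      Comp_assoc[OF assms d(3) d(2)] d(4,5) Comp_Idn_left[OF assms] by simp
qed

lemma homotopic_sym:
  assumes "homotopic C F f g"
  shows "homotopic C F g f"
proof -
  obtain P d0 d1 s H where "is_path_object C F (Cod C f) P d0 d1 s" "H \<in> hom C (Dom C f) P"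
    "d0 \<cdot> H = f" "d1 \<cdot> H = g"
    using assms unfolding homotopic_def by blast
  then show ?thesis using homotopicI[OF path_object_swap] by blast
qed

text \<open>
  In the next lemma \<open>Q = X \<times>\<^sub>B PB\<close> is the mapping path space of \<open>p\<close>. The map \<open>t = (1, s p)\<close> is
  anodyne because it is the base change of \<open>s\<close> along the fibration \<open>q2 : Q \<rightarrow> PB\<close>.
\<close>

lemma mapping_path_space:
  assumes P: "is_path_object C F B P d0 d1 s" and p: "p \<in> F" "p \<in> hom C X B"
  obtains Q q1 q2 t where "is_pullback C p d0 q1 q2" "q1 \<in> hom C Q X" "q2 \<in> hom C Q P"
    "t \<in> hom C X Q" "q1 \<cdot> t = Idn C X" "q2 \<cdot> t = s \<cdot> p" "is_anodyne C F t"
proof -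
  note d = path_object_hom[OF P]
  obtain q1 q2 where pb: "is_pullback C p d0 q1 q2"
    using fibre_product_exists[of d0 p] path_object_fibration[OF P] homD[OF d(1)] homD[OF p(2)]
    by auto
  let ?Q = "Dom C q1"
  note q = pullback_square[OF pb p(2) d(1)]
  have q2: "q2 \<in> F" using base_change_fibration[OF p(1) pullback_swap[OF pb]] .
  have X: "Idn C X \<in> hom C X X" using Idn_in_hom homD(4)[OF p(2)] .
  have "p \<cdot> Idn C X = d0 \<cdot> (s \<cdot> p)"
    using Comp_Idn_right[OF p(2)] Comp_assoc[OF p(2) d(3) d(1)] d(4) Comp_Idn_left[OF p(2)] by simp
  then obtain t where t: "t \<in> hom C X ?Q" "q1 \<cdot> t = Idn C X" "q2 \<cdot> t = s \<cdot> p"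
    using pullback_ex1[OF pb p(2) d(1) X Comp_in_hom[OF p(2) d(3)]] by blast
  have "is_pullback C s q2 p t"
  proof (rule is_pullbackI[OF d(3) q(2) p(2) t(1) t(3)[symmetric]])
    fix Y a e assume a: "a \<in> hom C Y B" and e: "e \<in> hom C Y ?Q" and eq: "s \<cdot> a = q2 \<cdot> e"
    \<comment> \<open>If the path component of \<open>e\<close> is constant at \<open>a\<close>,
      then \<open>e\<close> is determined by its point \<open>q1 \<cdot> e\<close>, which is
      therefore the mediating map.\<close>
    have h: "q1 \<cdot> e \<in> hom C Y X" using Comp_in_hom e q(1) .
    have ph: "p \<cdot> (q1 \<cdot> e) = a"
      using Comp_assoc[OF e q(1) p(2)] Comp_assoc[OF e q(2) d(1)] Comp_assoc[OF a d(3) d(1)]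
        q(3) eq d(4) Comp_Idn_left[OF a] by simp
    have "q1 \<cdot> (t \<cdot> (q1 \<cdot> e)) = q1 \<cdot> e" "q2 \<cdot> (t \<cdot> (q1 \<cdot> e)) = q2 \<cdot> e"
      using Comp_assoc[OF h t(1) q(1)] Comp_assoc[OF h t(1) q(2)] t(2,3) Comp_Idn_left[OF h]
        Comp_assoc[OF h p(2) d(3)] ph eq by simp_all
    then have th: "t \<cdot> (q1 \<cdot> e) = e"
      using pullback_eqI[OF pb p(2) d(1) Comp_in_hom[OF h t(1)] e] by blast
    have uniq: "h' = q1 \<cdot> e" if "h' \<in> hom C Y X" "t \<cdot> h' = e" for h'
      using Comp_assoc[OF that(1) t(1) q(1)] t(2) Comp_Idn_left[OF that(1)] that(2) by simp
    show "\<exists>!h. h \<in> hom C Y X \<and> p \<cdot> h = a \<and> t \<cdot> h = e"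
      by (rule ex1I[where a = "q1 \<cdot> e"]) (simp add: h ph th, elim conjE, rule uniq)
  qed
  then have "is_anodyne C F t" using base_change_anodyne[OF d(6) q2] by blast
  then show ?thesis using that pb q t by blast
qed

text \<open>Fibrations allow a homotopy below to be replaced by a strict equality: \<open>h'\<close>
  is \<open>h\<close> transported along the given homotopy.\<close>

lemma homotopy_lifting:
  assumes p: "p \<in> F" "p \<in> hom C X B" and h: "h \<in> hom C A X" and hk: "homotopic C F (p \<cdot> h) k"
  obtains h' where "h' \<in> hom C A X" "homotopic C F h h'" "p \<cdot> h' = k"
proof -
  obtain P d0 d1 s where P: "is_path_object C F B P d0 d1 s"
    using path_object_exists homD(5)[OF p(2)] by blast
  note d = path_object_hom[OF P]
  obtain Q q1 q2 t where pb: "is_pullback C p d0 q1 q2" and q: "q1 \<in> hom C Q X" "q2 \<in> hom C Q P"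
    and t: "t \<in> hom C X Q" "q1 \<cdot> t = Idn C X" "q2 \<cdot> t = s \<cdot> p" "is_anodyne C F t"
    using mapping_path_space[OF P p] .
  have ph: "p \<cdot> h \<in> hom C A B" using Comp_in_hom h p(2) .
  obtain H where H: "H \<in> hom C A P" "d0 \<cdot> H = p \<cdot> h" "d1 \<cdot> H = k"
    using homotopicE[OF hk ph P] by blast
  have X: "Idn C X \<in> hom C X X" using Idn_in_hom homD(4)[OF p(2)] .
  have "p \<cdot> Idn C X = (d1 \<cdot> q2) \<cdot> t"
    using Comp_assoc[OF t(1) q(2) d(2)] t(3) Comp_assoc[OF p(2) d(3) d(2)] d(5)
      Comp_Idn_left[OF p(2)] Comp_Idn_right[OF p(2)] by simp
  \<comment> \<open>\<open>l\<close> is transport: it moves a point of \<open>X\<close> along a path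
    in \<open>B\<close> that starts below it, and fixes the point when the path is constant.\<close>
  then obtain l where l: "l \<in> hom C Q X" "l \<cdot> t = Idn C X" "p \<cdot> l = d1 \<cdot> q2"
    using anodyne_lift[OF t(4,1) p X Comp_in_hom[OF q(2) d(2)]] by blast
  \<comment> \<open>\<open>m\<close> pairs the starting map \<open>h\<close> with the path
    \<open>H\<close>, so \<open>l \<cdot> m\<close> is the transported map.\<close>
  obtain m where m: "m \<in> hom C A Q" "q1 \<cdot> m = h" "q2 \<cdot> m = H"
    using pullback_ex1[OF pb p(2) d(1) h H(1)] H(2) homD[OF q(1)] by auto
  \<comment> \<open>Forgetting the path and transporting along it agree on constant paths, that is,
    after the anodyne map \<open>t\<close>.\<close>
  have "homotopic C F q1 l" using anodyne_comp_eq_homotopic[OF t(4,1) q(1) l(1)] t(2) l(2) by simp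
  then obtain P' e0 e1 s' K where P': "is_path_object C F X P' e0 e1 s'"
    and K: "K \<in> hom C Q P'" "e0 \<cdot> K = q1" "e1 \<cdot> K = l"
    using homD[OF q(1)] unfolding homotopic_def by auto
  note e = path_object_hom[OF P']
  have "homotopic C F h (l \<cdot> m)"
    using homotopicI[OF P' Comp_in_hom[OF m(1) K(1)]] Comp_assoc[OF m(1) K(1) e(1)]
      Comp_assoc[OF m(1) K(1) e(2)] K(2,3) m(2) by simp
  moreover have "p \<cdot> (l \<cdot> m) = k"
    using Comp_assoc[OF m(1) l(1) p(2)] l(3) Comp_assoc[OF m(1) q(2) d(2)] m(3) H(3) by simp
  ultimately show ?thesis using that Comp_in_hom[OF m(1) l(1)] by blast
qed

lemma homotopic_trans:
  assumes fg: "homotopic C F f g" and gh: "homotopic C F g h"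
  shows "homotopic C F f h"
proof -
  define A B where "A = Dom C f" and "B = Cod C f"
  have f: "f \<in> hom C A B" using fg unfolding homotopic_def hom_def A_def B_def by auto
  have g: "g \<in> hom C A B" using homotopic_hom fg f by blast
  obtain P d0 d1 s where P: "is_path_object C F B P d0 d1 s"
    using path_object_exists homD(5)[OF f] by blast
  note d = path_object_hom[OF P]
  obtain H K where H: "H \<in> hom C A P" "d0 \<cdot> H = f" "d1 \<cdot> H = g"
    and K: "K \<in> hom C A P" "d0 \<cdot> K = g" "d1 \<cdot> K = h"
    using homotopicE[OF fg f P] homotopicE[OF gh g P] by metis
  \<comment> \<open>As \<open>d1\<close> is itself a fibration, its mapping path space is available.
    It is the object of composable pairs of paths, and \<open>t\<close> appends a constant
    path.\<close>
  obtain Q q1 q2 t where pb: "is_pullback C d1 d0 q1 q2" and q: "q1 \<in> hom C Q P" "q2 \<in> hom C Q P"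
    and t: "t \<in> hom C P Q" "q1 \<cdot> t = Idn C P" "q2 \<cdot> t = s \<cdot> d1" "is_anodyne C F t"
    using mapping_path_space[OF P path_object_fibration[OF path_object_swap[OF P]] d(2)] .
  have PI: "Idn C P \<in> hom C P P" using Idn_in_hom homD(4)[OF d(1)] .
  have "d0 \<cdot> Idn C P = (d0 \<cdot> q1) \<cdot> t" using Comp_assoc[OF t(1) q(1) d(1)] t(2) by simp
  moreover have "d1 \<cdot> Idn C P = (d1 \<cdot> q2) \<cdot> t"
    using Comp_assoc[OF t(1) q(2) d(2)] t(3) Comp_assoc[OF d(2) d(3) d(2)] d(5)
      Comp_Idn_left[OF d(2)] Comp_Idn_right[OF d(2)] by simp
  \<comment> \<open>\<open>w\<close> is concatenation of paths, obtained by extending the identity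
    of \<open>P\<close> along \<open>t\<close>.\<close>
  ultimately obtain w where w: "w \<in> hom C Q P" "d0 \<cdot> w = d0 \<cdot> q1" "d1 \<cdot> w = d1 \<cdot> q2"
    using path_object_lift[OF P t(4,1) PI Comp_in_hom[OF q(1) d(1)] Comp_in_hom[OF q(2) d(2)]]
    by blast
  obtain m where m: "m \<in> hom C A Q" "q1 \<cdot> m = H" "q2 \<cdot> m = K"
    using pullback_ex1[OF pb d(2,1) H(1) K(1)] H(3) K(2) homD[OF q(1)] by auto
  show ?thesis
    using homotopicI[OF P Comp_in_hom[OF m(1) w(1)]] Comp_assoc[OF m(1) w(1) d(1)]
      Comp_assoc[OF m(1) w(1) d(2)] Comp_assoc[OF m(1) q(1) d(1)] Comp_assoc[OF m(1) q(2) d(2)]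
      w(2,3) m(2,3) H(2) K(3) by simp
qed

lemma homotopic_comp_right:
  assumes fg: "homotopic C F f g" and f: "f \<in> hom C A B" and k: "k \<in> hom C X A"
  shows "homotopic C F (f \<cdot> k) (g \<cdot> k)"
proof -
  obtain P d0 d1 s where P: "is_path_object C F B P d0 d1 s"
    using path_object_exists homD(5)[OF f] by blast
  note d = path_object_hom[OF P]
  obtain H where H: "H \<in> hom C A P" "d0 \<cdot> H = f" "d1 \<cdot> H = g"
    using homotopicE[OF fg f P] .
  show ?thesis
    using homotopicI[OF P Comp_in_hom[OF k H(1)]] Comp_assoc[OF k H(1) d(1)]
      Comp_assoc[OF k H(1) d(2)] H(2,3) by simp
qed

text \<open>Reduces to the universal homotopy from \<open>d0\<close> to \<open>d1\<close>: the maps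
  \<open>k \<cdot> d0\<close> and \<open>k \<cdot> d1\<close> agree after the anodyne map
  \<open>s\<close>, hence are homotopic, and precomposition with \<open>H\<close> gives the general
  case.\<close>

lemma homotopic_comp_left:
  assumes fg: "homotopic C F f g" and f: "f \<in> hom C A B" and k: "k \<in> hom C B X"
  shows "homotopic C F (k \<cdot> f) (k \<cdot> g)"
proof -
  obtain P d0 d1 s where P: "is_path_object C F B P d0 d1 s"
    using path_object_exists homD(5)[OF f] by blast
  note d = path_object_hom[OF P]
  obtain H where H: "H \<in> hom C A P" "d0 \<cdot> H = f" "d1 \<cdot> H = g"
    using homotopicE[OF fg f P] .
  have kd: "k \<cdot> d0 \<in> hom C P X" "k \<cdot> d1 \<in> hom C P X" using Comp_in_hom d k by blast+
  have "homotopic C F (k \<cdot> d0) (k \<cdot> d1)"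
    using anodyne_comp_eq_homotopic[OF d(6,3) kd] Comp_assoc[OF d(3) d(1) k]
      Comp_assoc[OF d(3) d(2) k] d(4,5) by simp
  from homotopic_comp_right[OF this kd(1) H(1)] show ?thesis
    using Comp_assoc[OF H(1) d(1) k] Comp_assoc[OF H(1) d(2) k] H(2,3) by simp
qed

lemma equiv_homotopy_rel: "equiv (Mor C) (homotopy_rel C F)"
proof (rule equivI)
  show "homotopy_rel C F \<subseteq> Mor C \<times> Mor C"
    unfolding homotopy_rel_def homotopic_def hom_def by auto
  show "refl_on (Mor C) (homotopy_rel C F)"
    using homotopic_refl by (auto simp: refl_on_def homotopy_rel_def hom_def)
  show "sym (homotopy_rel C F)"
    using homotopic_sym by (auto simp: sym_def homotopy_rel_def)
  show "trans (homotopy_rel C F)"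
    using homotopic_trans by (auto simp: trans_def homotopy_rel_def)
qed

section \<open>The homotopy category on representatives\<close>

abbreviation htpy_class where "htpy_class f \<equiv> homotopy_rel C F `` {f}"
abbreviation Ho where "Ho \<equiv> homotopy_category C F"

lemma mem_htpy_class: "g \<in> htpy_class f \<longleftrightarrow> homotopic C F f g"
  by (simp add: homotopy_rel_def)

lemma htpy_class_eq_iff:
  assumes "f \<in> Mor C" "g \<in> Mor C"
  shows "htpy_class f = htpy_class g \<longleftrightarrow> homotopic C F f g"
  using eq_equiv_class_iff[OF equiv_homotopy_rel assms] by (simp add: homotopy_rel_def)

lemma htpy_class_in_hom:
  assumes "f \<in> hom C A B"
  shows "htpy_class f \<in> hom Ho A B"
proof -
  have f: "f \<in> htpy_class f" using mem_htpy_class homotopic_refl[OF assms] by blast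
  have "g \<in> hom C A B" if "g \<in> htpy_class f" for g
    using that mem_htpy_class homotopic_hom assms by blast
  \<comment> \<open>Homotopic maps are parallel, so these images are singletons and
    \<open>the_elem\<close> returns the expected endpoints.\<close>
  then have "Dom C ` htpy_class f = {A}" "Cod C ` htpy_class f = {B}"
    using f homD by blast+
  then show ?thesis
    using homD(1)[OF assms] by (auto simp: homotopy_category_def hom_def intro: quotientI)
qed

lemma hom_HoE:
  assumes "c \<in> hom Ho A B"
  obtains f where "f \<in> hom C A B" "c = htpy_class f"
proof -
  have "c \<in> Mor C // homotopy_rel C F" using assms by (simp add: hom_def homotopy_category_def)
  then obtain f where f: "f \<in> Mor C" "c = htpy_class f" by (rule quotientE)
  then have "c \<in> hom Ho (Dom C f) (Cod C f)" using htpy_class_in_hom by (simp add: hom_def)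
  then show ?thesis using assms f that by (simp add: hom_def)
qed

text \<open>Composition in \<open>Ho\<close> is a union over all representatives; by the congruence
  property all its members coincide.\<close>

lemma Comp_Ho:
  assumes f: "f \<in> hom C X Y" and g: "g \<in> hom C Y Z"
  shows "htpy_class g \<cdot>\<^bsub>Ho\<^esub> htpy_class f = htpy_class (g \<cdot> f)"
proof -
  have "htpy_class (g' \<cdot> f') = htpy_class (g \<cdot> f)"
    if "f' \<in> htpy_class f" "g' \<in> htpy_class g" for f' g'
  proof -
    have *: "homotopic C F f f'" "homotopic C F g g'" using that mem_htpy_class by blast+
    have f': "f' \<in> hom C X Y" and g': "g' \<in> hom C Y Z" using * homotopic_hom f g by blast+
    have "homotopic C F (g \<cdot> f) (g' \<cdot> f')"
      using homotopic_trans homotopic_comp_left[OF *(1) f g] homotopic_comp_right[OF *(2) g f']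
      by blast
    then show ?thesis using htpy_class_eq_iff Comp_in_hom[OF f g] Comp_in_hom[OF f' g'] homD(1) by blast
  qed
  moreover have "f \<in> htpy_class f" "g \<in> htpy_class g"
    using mem_htpy_class homotopic_refl f g by blast+
  ultimately have "(\<Union>v \<in> htpy_class g. \<Union>u \<in> htpy_class f. htpy_class (v \<cdot> u)) = htpy_class (g \<cdot> f)"
    by blast
  then show ?thesis by (simp add: homotopy_category_def)
qed

text \<open>Replaces invertibility in \<open>Ho\<close> by a two-sided homotopy inverse, so that
  most later arguments take place in \<open>C\<close>.\<close>

lemma homotopy_equivalence_iff:
  assumes f: "f \<in> hom C A B"
  shows "f \<in> homotopy_equivalences C F \<longleftrightarrow>
    (\<exists>g \<in> hom C B A. homotopic C F (g \<cdot> f) (Idn C A) \<and> homotopic C F (f \<cdot> g) (Idn C B))"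
proof -
  have Idn: "Idn Ho X = htpy_class (Idn C X)" for X by (simp add: homotopy_category_def)
  have I: "Idn C A \<in> Mor C" "Idn C B \<in> Mor C" using Idn_in_hom homD f by blast+
  have comp: "htpy_class g \<cdot>\<^bsub>Ho\<^esub> htpy_class f = htpy_class (Idn C A) \<longleftrightarrow> homotopic C F (g \<cdot> f) (Idn C A)"
    "htpy_class f \<cdot>\<^bsub>Ho\<^esub> htpy_class g = htpy_class (Idn C B) \<longleftrightarrow> homotopic C F (f \<cdot> g) (Idn C B)"
    if "g \<in> hom C B A" for g
    using Comp_Ho[OF f that] Comp_Ho[OF that f] htpy_class_eq_iff I homD(1)[OF Comp_in_hom[OF f that]]
      homD(1)[OF Comp_in_hom[OF that f]] by simp_all
  have cf: "htpy_class f \<in> Mor Ho" "Dom Ho (htpy_class f) = A" "Cod Ho (htpy_class f) = B"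
    using htpy_class_in_hom[OF f] by (simp_all add: hom_def)
  have "f \<in> homotopy_equivalences C F \<longleftrightarrow>
    (\<exists>c \<in> hom Ho B A. c \<cdot>\<^bsub>Ho\<^esub> htpy_class f = htpy_class (Idn C A)
      \<and> htpy_class f \<cdot>\<^bsub>Ho\<^esub> c = htpy_class (Idn C B))"
    unfolding homotopy_equivalences_def is_iso_def using homD(1)[OF f] cf Idn by simp
  also have "\<dots> \<longleftrightarrow> (\<exists>g \<in> hom C B A. htpy_class g \<cdot>\<^bsub>Ho\<^esub> htpy_class f = htpy_class (Idn C A)
      \<and> htpy_class f \<cdot>\<^bsub>Ho\<^esub> htpy_class g = htpy_class (Idn C B))"
    using hom_HoE htpy_class_in_hom by metis
  finally show ?thesis using comp by blast
qed

section \<open>Homotopy equivalences: examples and 3-for-2\<close>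

lemma homotopic_reassoc:
  assumes uv: "u \<in> hom C X Y" "v \<in> hom C Y Z" "w \<in> hom C Z W"
    and h: "homotopic C F (w \<cdot> v) r" "homotopic C F (v \<cdot> u) r'"
  shows "homotopic C F (w \<cdot> r') (r \<cdot> u)"
proof -
  have "homotopic C F ((w \<cdot> v) \<cdot> u) (r \<cdot> u)"
    using homotopic_comp_right[OF h(1) Comp_in_hom[OF uv(2,3)] uv(1)] .
  moreover have "homotopic C F (w \<cdot> (v \<cdot> u)) (w \<cdot> r')"
    using homotopic_comp_left[OF h(2) Comp_in_hom[OF uv(1,2)] uv(3)] .
  ultimately show ?thesis using Comp_assoc[OF uv] homotopic_sym homotopic_trans by metis
qed

text \<open>A left and a right homotopy inverse of \<open>f\<close> are homotopic to each other, by
  reassociating \<open>g \<cdot> f \<cdot> g'\<close>. So \<open>g\<close> is inverse to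
  \<open>f\<close> on both sides.\<close>

lemma left_inverse_homotopy_equivalence:
  assumes f: "f \<in> hom C A B" and g: "g \<in> hom C B A" "homotopic C F (g \<cdot> f) (Idn C A)"
    and g': "g' \<in> hom C B A" "homotopic C F (f \<cdot> g') (Idn C B)"
  shows "g \<in> homotopy_equivalences C F"
proof -
  have gg': "homotopic C F g g'"
    using homotopic_reassoc[OF g'(1) f g(1) g(2) g'(2)] Comp_Idn_left[OF g'(1)]
      Comp_Idn_right[OF g(1)] by simp
  have gf: "homotopic C F (f \<cdot> g) (Idn C B)"
    using homotopic_comp_left[OF gg' g(1) f] g'(2) homotopic_trans by blast
  show "g \<in> homotopy_equivalences C F" using homotopy_equivalence_iff[OF g(1)] g gf f by blast
qed

lemma iso_homotopy_equivalence:
  assumes "is_iso C f"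
  shows "f \<in> homotopy_equivalences C F"
proof -
  have f: "f \<in> hom C (Dom C f) (Cod C f)" using assms by (simp add: is_iso_def hom_def)
  obtain g where g: "g \<in> hom C (Cod C f) (Dom C f)" "g \<cdot> f = Idn C (Dom C f)" "f \<cdot> g = Idn C (Cod C f)"
    using assms unfolding is_iso_def by blast
  then show ?thesis
    using homotopy_equivalence_iff[OF f] homotopic_refl Comp_in_hom f by metis
qed

text \<open>Since \<open>A\<close> is fibrant over the terminal object, the identity of
  \<open>A\<close> extends along \<open>i\<close> to a strict retraction \<open>r\<close>. Then
  \<open>i \<cdot> r\<close> and the identity of \<open>B\<close> agree after \<open>i\<close>,
  hence are homotopic.\<close>

lemma anodyne_homotopy_equivalence:
  assumes "is_anodyne C F i"
  shows "i \<in> homotopy_equivalences C F"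
proof -
  define A B where "A = Dom C i" and "B = Cod C i"
  have i: "i \<in> hom C A B" using assms unfolding is_anodyne_def hom_def A_def B_def by auto
  note ob = homD(4,5)[OF i]
  obtain T where T: "is_terminal C T" "\<forall>X \<in> Ob C. hom C X T \<subseteq> F"
    using terminal_fibration by blast
  obtain a b where a: "a \<in> hom C A T" and b: "b \<in> hom C B T"
    using T(1) ob unfolding is_terminal_def by blast
  have I: "Idn C A \<in> hom C A A" "Idn C B \<in> hom C B B" using Idn_in_hom ob by auto
  have "a \<cdot> Idn C A = b \<cdot> i"
    using T(1) ob Comp_in_hom[OF I(1) a] Comp_in_hom[OF i b] unfolding is_terminal_def by blast
  then obtain r where r: "r \<in> hom C B A" "r \<cdot> i = Idn C A"
    using anodyne_lift[OF assms i _ a I(1) b] T(2) ob a by blast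
  have "(i \<cdot> r) \<cdot> i = Idn C B \<cdot> i"
    using Comp_assoc[OF i r(1) i] r(2) Comp_Idn_left[OF i] Comp_Idn_right[OF i] by simp
  then have "homotopic C F (i \<cdot> r) (Idn C B)"
    using anodyne_comp_eq_homotopic[OF assms i Comp_in_hom[OF r(1) i] I(2)] by blast
  then show ?thesis using homotopy_equivalence_iff[OF i] r homotopic_refl[OF I(1)] by metis
qed

text \<open>One half of the inverse law for a composite; exchanging the maps with their inverses
  gives the other half.\<close>

lemma homotopic_comp_inverse:
  assumes "u \<in> hom C X Y" "v \<in> hom C Y Z" "v' \<in> hom C Z Y" "u' \<in> hom C Y X"
    and "homotopic C F (v' \<cdot> v) (Idn C Y)" "homotopic C F (u' \<cdot> u) (Idn C X)"
  shows "homotopic C F ((u' \<cdot> v') \<cdot> (v \<cdot> u)) (Idn C X)"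
proof -
  have vu: "v \<cdot> u \<in> hom C X Z" using Comp_in_hom assms(1,2) .
  have "homotopic C F ((v' \<cdot> v) \<cdot> u) (Idn C Y \<cdot> u)"
    using homotopic_comp_right[OF assms(5) Comp_in_hom[OF assms(2,3)] assms(1)] .
  then have "homotopic C F (v' \<cdot> (v \<cdot> u)) u"
    using Comp_assoc[OF assms(1-3)] Comp_Idn_left[OF assms(1)] by simp
  from homotopic_comp_left[OF this Comp_in_hom[OF vu assms(3)] assms(4)]
  show ?thesis using Comp_assoc[OF vu assms(3,4)] assms(6) homotopic_trans by metis
qed

lemma homotopy_equivalence_comp:
  assumes u: "u \<in> hom C X Y" and v: "v \<in> hom C Y Z"
    and W: "u \<in> homotopy_equivalences C F" "v \<in> homotopy_equivalences C F"
  shows "v \<cdot> u \<in> homotopy_equivalences C F"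
proof -
  obtain u' where u': "u' \<in> hom C Y X" "homotopic C F (u' \<cdot> u) (Idn C X)" "homotopic C F (u \<cdot> u') (Idn C Y)"
    using W(1) homotopy_equivalence_iff[OF u] by blast
  obtain v' where v': "v' \<in> hom C Z Y" "homotopic C F (v' \<cdot> v) (Idn C Y)" "homotopic C F (v \<cdot> v') (Idn C Z)"
    using W(2) homotopy_equivalence_iff[OF v] by blast
  show ?thesis
    using homotopy_equivalence_iff[OF Comp_in_hom[OF u v]] Comp_in_hom[OF v'(1) u'(1)]
      homotopic_comp_inverse[OF u v v'(1) u'(1) v'(2) u'(2)]
      homotopic_comp_inverse[OF v'(1) u'(1) u v u'(3) v'(3)] by blast
qed

lemma homotopy_equivalence_homotopic:
  assumes f: "f \<in> hom C A B" and fg: "homotopic C F f g" and W: "f \<in> homotopy_equivalences C F"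
  shows "g \<in> homotopy_equivalences C F"
proof -
  have g: "g \<in> Mor C" using fg f homotopic_hom homD(1) by blast
  then have "htpy_class f = htpy_class g" using htpy_class_eq_iff homD(1)[OF f] fg by blast
  then show ?thesis using W g unfolding homotopy_equivalences_def by simp
qed

text \<open>A homotopy inverse \<open>v'\<close> of \<open>v\<close> is again an equivalence, and
  \<open>v' \<cdot> (v \<cdot> u)\<close> is homotopic to \<open>u\<close>; closure under
  composition and homotopy finishes.\<close>

lemma homotopy_equivalence_cancel_left:
  assumes u: "u \<in> hom C X Y" and v: "v \<in> hom C Y Z"
    and W: "v \<in> homotopy_equivalences C F" "v \<cdot> u \<in> homotopy_equivalences C F"
  shows "u \<in> homotopy_equivalences C F"
proof -
  obtain v' where v': "v' \<in> hom C Z Y" "homotopic C F (v' \<cdot> v) (Idn C Y)" "homotopic C F (v \<cdot> v') (Idn C Z)"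
    using W(1) homotopy_equivalence_iff[OF v] by blast
  have vu: "v \<cdot> u \<in> hom C X Z" using Comp_in_hom u v .
  have "v' \<in> homotopy_equivalences C F" using homotopy_equivalence_iff[OF v'(1)] v v' by blast
  then have 1: "v' \<cdot> (v \<cdot> u) \<in> homotopy_equivalences C F"
    using homotopy_equivalence_comp[OF vu v'(1)] W(2) by blast
  have "homotopic C F (v' \<cdot> (v \<cdot> u)) u"
    using homotopic_comp_right[OF v'(2) Comp_in_hom[OF v v'(1)] u] Comp_assoc[OF u v v'(1)]
      Comp_Idn_left[OF u] by simp
  then show ?thesis using homotopy_equivalence_homotopic[OF Comp_in_hom[OF vu v'(1)] _ 1] by blast
qed

lemma homotopy_equivalence_cancel_right:
  assumes u: "u \<in> hom C X Y" and v: "v \<in> hom C Y Z"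
    and W: "u \<in> homotopy_equivalences C F" "v \<cdot> u \<in> homotopy_equivalences C F"
  shows "v \<in> homotopy_equivalences C F"
proof -
  obtain u' where u': "u' \<in> hom C Y X" "homotopic C F (u' \<cdot> u) (Idn C X)" "homotopic C F (u \<cdot> u') (Idn C Y)"
    using W(1) homotopy_equivalence_iff[OF u] by blast
  have vu: "v \<cdot> u \<in> hom C X Z" using Comp_in_hom u v .
  have "u' \<in> homotopy_equivalences C F" using homotopy_equivalence_iff[OF u'(1)] u u' by blast
  then have 1: "(v \<cdot> u) \<cdot> u' \<in> homotopy_equivalences C F"
    using homotopy_equivalence_comp[OF u'(1) vu] W(2) by blast
  have "homotopic C F ((v \<cdot> u) \<cdot> u') v"
    using homotopic_comp_left[OF u'(3) Comp_in_hom[OF u'(1) u] v] Comp_assoc[OF u'(1) u v]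
      Comp_Idn_right[OF v] by simp
  then show ?thesis using homotopy_equivalence_homotopic[OF Comp_in_hom[OF u'(1) vu] _ 1] by blast
qed

section \<open>Base change of acyclic fibrations\<close>

lemma acyclic_fibration_section:
  assumes p: "p \<in> F" "p \<in> hom C X B" and W: "p \<in> homotopy_equivalences C F"
  obtains s where "s \<in> hom C B X" "p \<cdot> s = Idn C B" "homotopic C F (s \<cdot> p) (Idn C X)"
proof -
  obtain g where g: "g \<in> hom C B X" "homotopic C F (g \<cdot> p) (Idn C X)" "homotopic C F (p \<cdot> g) (Idn C B)"
    using W homotopy_equivalence_iff[OF p(2)] by blast
  \<comment> \<open>Lifting the homotopy from \<open>p \<cdot> g\<close> to the identity deforms the
    homotopy inverse \<open>g\<close> into a strict section.\<close>
  obtain s where s: "s \<in> hom C B X" "homotopic C F g s" "p \<cdot> s = Idn C B"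
    using homotopy_lifting[OF p g(1,3)] .
  have "homotopic C F (s \<cdot> p) (Idn C X)"
    using homotopic_comp_right[OF s(2) g(1) p(2)] g(2) homotopic_sym homotopic_trans by blast
  then show ?thesis using that s by blast
qed

lemma base_change_acyclic_along_fibration:
  assumes p: "p \<in> F" "p \<in> hom C X B" "p \<in> homotopy_equivalences C F"
    and f: "f \<in> F" "f \<in> hom C A B" and pb: "is_pullback C f p p' f'"
  shows "p' \<in> homotopy_equivalences C F"
proof -
  define Y where "Y = Dom C p'"
  have q: "p' \<in> hom C Y A" "f' \<in> hom C Y X" "f \<cdot> p' = p \<cdot> f'"
    using pullback_square[OF pb f(2) p(2)] by (simp_all add: Y_def)
  have f': "f' \<in> F" using base_change_fibration[OF f(1) pullback_swap[OF pb]] .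
  have I: "Idn C A \<in> hom C A A" "Idn C Y \<in> hom C Y Y" using Idn_in_hom homD q(1) by blast+
  obtain s where s: "s \<in> hom C B X" "p \<cdot> s = Idn C B" "homotopic C F (s \<cdot> p) (Idn C X)"
    using acyclic_fibration_section[OF p] .
  have sf: "s \<cdot> f \<in> hom C A X" using Comp_in_hom f(2) s(1) .
  have psf: "p \<cdot> (s \<cdot> f) = f"
    using Comp_assoc[OF f(2) s(1) p(2)] s(2) Comp_Idn_left[OF f(2)] by simp
  obtain s' where s': "s' \<in> hom C A Y" "p' \<cdot> s' = Idn C A" "f' \<cdot> s' = s \<cdot> f"
    using pullback_ex1[OF pb f(2) p(2) I(1) sf] psf Comp_Idn_right[OF f(2)] by (auto simp: Y_def)
  have spf: "(s \<cdot> p) \<cdot> f' = (s \<cdot> f) \<cdot> p'"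
    using Comp_assoc[OF q(2) p(2) s(1)] Comp_assoc[OF q(1) f(2) s(1)] q(3) by simp
  have "homotopic C F ((s \<cdot> p) \<cdot> f') f'"
    using homotopic_comp_right[OF s(3) Comp_in_hom[OF p(2) s(1)] q(2)] Comp_Idn_left[OF q(2)] by simp
  then have "homotopic C F (f' \<cdot> Idn C Y) ((s \<cdot> f) \<cdot> p')"
    using spf Comp_Idn_right[OF q(2)] homotopic_sym by simp
  then obtain e where e: "e \<in> hom C Y Y" "homotopic C F (Idn C Y) e" "f' \<cdot> e = (s \<cdot> f) \<cdot> p'"
    using homotopy_lifting[OF f' q(2) I(2)] by blast
  have pe: "p' \<cdot> e \<in> hom C Y A" using Comp_in_hom e(1) q(1) .
  \<comment> \<open>\<open>f\<close> does not distinguish \<open>p' \<cdot> e\<close> from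
    \<open>p'\<close>. This suffices for the comparison of \<open>X\<close>-components below,
    because \<open>s'\<close> reaches \<open>X\<close> only through \<open>f\<close>.\<close>
  have fpe: "f \<cdot> (p' \<cdot> e) = f \<cdot> p'"
    using Comp_assoc[OF e(1) q(1) f(2)] Comp_assoc[OF e(1) q(2) p(2)] q(3) e(3)
      Comp_assoc[OF q(1) sf p(2)] psf by simp
  have "s' \<cdot> (p' \<cdot> e) = e"
  proof (rule pullback_eqI[OF pb f(2) p(2), where X = Y])
    show "p' \<cdot> (s' \<cdot> (p' \<cdot> e)) = p' \<cdot> e"
      using Comp_assoc[OF pe s'(1) q(1)] s'(2) Comp_Idn_left[OF pe] by simp
    show "f' \<cdot> (s' \<cdot> (p' \<cdot> e)) = f' \<cdot> e"
      using Comp_assoc[OF pe s'(1) q(2)] s'(3) Comp_assoc[OF pe f(2) s(1)] fpe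
        Comp_assoc[OF q(1) f(2) s(1)] e(3) by simp
  qed (use e(1) Comp_in_hom[OF pe s'(1)] in \<open>simp_all add: Y_def\<close>)
  then have "homotopic C F (s' \<cdot> (p' \<cdot> e)) (Idn C Y)" using homotopic_sym[OF e(2)] by simp
  moreover have "homotopic C F (p' \<cdot> s') (Idn C A)" using homotopic_refl[OF I(1)] s'(2) by simp
  ultimately show ?thesis using left_inverse_homotopy_equivalence[OF s'(1) q(1) _ pe] by blast
qed

lemma base_change_acyclic:
  assumes p: "p \<in> F" "p \<in> homotopy_equivalences C F" and pb: "is_pullback C f p q1 q2"
  shows "q1 \<in> homotopy_equivalences C F"
proof -
  define A B X where "A = Dom C f" and "B = Cod C p" and "X = Dom C p"
  have f: "f \<in> hom C A B" and pX: "p \<in> hom C X B"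
    using pb unfolding is_pullback_def hom_def A_def B_def X_def by auto
  obtain j g where jg: "is_anodyne C F j" "g \<in> F" "Dom C g = Cod C j" "g \<cdot> j = f"
    using anodyne_factorization homD(1)[OF f] by blast
  define Z where "Z = Cod C j"
  have j0: "j \<in> hom C (Dom C j) Z" and g0: "g \<in> hom C Z (Cod C g)"
    using jg fibrations_subset unfolding is_anodyne_def hom_def Z_def by auto
  have "Dom C j = A" "Cod C g = B"
    using Comp_in_hom[OF j0 g0] jg(4) homD[OF f] homD by auto
  then have j: "j \<in> hom C A Z" and g: "g \<in> hom C Z B" using j0 g0 by auto
  obtain r1 r2 where r: "is_pullback C g p r1 r2"
    using fibre_product_exists[OF p(1), of g] homD[OF g] homD[OF pX] by auto
  \<comment> \<open>By pasting, \<open>q1\<close> is the base change of \<open>r1\<close> along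
    \<open>j\<close>, and \<open>k\<close> is the base change of the anodyne \<open>j\<close> along
    the fibration \<open>r1\<close>. In \<open>j \<cdot> q1 = r1 \<cdot> k\<close> every map except
    \<open>q1\<close> is then known to be an equivalence.\<close>
  obtain k where k: "is_pullback C j r1 q1 k" "k \<in> hom C (Dom C q1) (Dom C r1)"
    using pullback_cancel[OF _ r j g pX] pb jg(4) by metis
  have r1: "r1 \<in> hom C (Dom C r1) Z" using pullback_square(1)[OF r g pX] .
  note q = pullback_square[OF k(1) j r1]
  have "r1 \<in> homotopy_equivalences C F"
    using base_change_acyclic_along_fibration[OF p(1) pX p(2) jg(2) g r] .
  moreover have "k \<in> homotopy_equivalences C F"
    using anodyne_homotopy_equivalence base_change_anodyne[OF jg(1) base_change_fibration[OF p(1) r] k(1)] .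
  ultimately have "j \<cdot> q1 \<in> homotopy_equivalences C F"
    using homotopy_equivalence_comp[OF k(2) r1] q(3) by simp
  then show ?thesis
    using homotopy_equivalence_cancel_left[OF q(1) j] anodyne_homotopy_equivalence[OF jg(1)] by blast
qed

end

theorem theorem3p5p6:
  fixes E :: "('o, 'm) cat" and F :: "'m set"
  assumes "tribe E F"
  shows "fibration_category E F (homotopy_equivalences E F)"
proof -
  interpret tribe E F by fact
  show ?thesis
  proof
    show "homotopy_equivalences E F \<subseteq> Mor E" unfolding homotopy_equivalences_def by blast
    show "\<exists>w p. w \<in> homotopy_equivalences E F \<and> p \<in> F \<and> Dom E p = Cod E w \<and> p \<cdot>\<^bsub>E\<^esub> w = f"
      if "f \<in> Mor E" for f
      using anodyne_factorization[OF that] anodyne_homotopy_equivalence by blast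
    show "q1 \<in> F \<inter> homotopy_equivalences E F"
      if "p \<in> F \<inter> homotopy_equivalences E F" "is_pullback E f p q1 q2" for p f q1 q2
      using that base_change_fibration base_change_acyclic by blast
  qed (fact iso_homotopy_equivalence homotopy_equivalence_comp
      homotopy_equivalence_cancel_left homotopy_equivalence_cancel_right)+
qed

end
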